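(* Let $C$ be a nonempty bounded closed convex subset of a real Hilbert space $H$, let $S$ be a semitopological semigroup, and let $\mathcal{S}=\{T_t : t\in S\}$ be a uniformly $k$-Lipschitzian semigroup on $C$. Let $X$ be a closed linear subspace of $\ell^\infty(S)$ containing the constant function $I_S$ and satisfying $l_s(X)\subset X$ and $r_s(X)\subset X$ for each $s\in S$. Suppose that $X$ is left amenable and that, for each $x\in C$ and $y\in H$, the functions $g(t)=\langle T_t x,y\rangle$ and $h(t)=\|T_t x-y\|^2$ ($t\in S$) belong to $X$. If $k<\sqrt{2}$, then $\mathcal{S}$ has a fixed point in $C$ (i.e. there is $x\in C$ with $T_t x=x$ for all $t\in S$), and the set $\operatorname{Fix}\mathcal{S}=\bigcap_{t\in S}\{x\in C: T_t x=x\}$ is a Hölder continuous retract of $C$.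
   Context: A semitopological semigroup is a semigroup $S$ with a Hausdorff topology such that for each $t\in S$ the maps $s\mapsto ts$ and $s\mapsto st$ from $S$ to $S$ are continuous; every semigroup is semitopological when given the discrete topology. No continuity of $t\mapsto T_t x$ is assumed. A family $\mathcal{S}=\{T_t:t\in S\}$ of mappings from $C$ into $C$ is a uniformly $k$-Lipschitzian semigroup on $C$ if $T_{ts}x=T_tT_sx$ and $\|T_tx-T_ty\|\le k\|x-y\|$ for all $t,s\in S$ and $x,y\in C$. $\ell^\infty(S)$ is the Banach space of bounded real-valued functions on $S$ with the supremum norm. For $s\in S$ and $f\in \ell^\infty(S)$, define $l_sf(t)=f(st)$ and $r_sf(t)=f(ts)$ for $t\in S$. $I_S$ is the function with $I_S(t)=1$ for all $t\in S$. A mean on $X$ is an element $\mu$ of the dual $X^*$ with $\|\mu\|=\mu(I_S)=1$. It is left invariant if $\mu(l_sf)=\mu(f)$ for all $s\in S$ and $f\in X$. $X$ is left amenable if there exists a left invariant mean on $X$. A subset $F\subset C$ is a Hölder continuous retract of $C$ if there is a mapping $R:C\to F$ with $Rx=x$ for all $x\in F$ that is Hölder continuous, i.e. there exist constants $M\ge 0$ and $0<\alpha\le 1$ such that $\|Rx-Ry\|\le M\|x-y\|^\alpha$ for all $x,y\in C$. *)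

theory Defs
  imports "HOL-Analysis.Analysis" "HOL-Probability.Discrete_Topology"
begin

class semitopological_semigroup = semigroup_mult + t2_space +
  assumes tendsto_mult_left_nhds: "((\<lambda>s. t * s) \<longlongrightarrow> t * a) (nhds a)"
    and tendsto_mult_right_nhds: "((\<lambda>s. s * t) \<longlongrightarrow> a * t) (nhds a)"

lemma semitopological_semigroup_continuous:
  fixes t :: "'s::semitopological_semigroup"
  shows "continuous_on UNIV (\<lambda>s. t * s)" and "continuous_on UNIV (\<lambda>s. s * t)"
  unfolding continuous_on_def at_within_def
  by (blast intro: tendsto_mono [OF inf_le1] tendsto_mult_left_nhds tendsto_mult_right_nhds)+

text \<open>
  The space of all bounded real functions on the type with the supremum norm. Passing to the
  discrete copy of the type makes every function continuous, so that the Banach space structure of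
  the bounded continuous functions can be used whatever topology the type itself carries.
\<close>

type_synonym 's linf = "'s discrete \<Rightarrow>\<^sub>C real"

definition linf_apply :: "'s linf \<Rightarrow> 's \<Rightarrow> real"
  where "linf_apply f t = apply_bcontfun f (discrete t)"

lemma bcontfun_discrete_iff: "f \<in> bcontfun \<longleftrightarrow> bounded (range f)"
  for f :: "'s discrete \<Rightarrow> real"
  by (auto simp: bcontfun_def continuous_on_open_vimage open_discrete)

lemma range_linf_apply: "range linf_apply = {f :: 's \<Rightarrow> real. bounded (range f)}"
proof (intro set_eqI iffI; clarify)
  fix g :: "'s linf"
  have "range (linf_apply g) \<subseteq> range (apply_bcontfun g)"
    by (auto simp: linf_apply_def)
  then show "bounded (range (linf_apply g))"
    using bounded_apply_bcontfun bounded_subset by blast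
next
  fix f :: "'s \<Rightarrow> real"
  assume "bounded (range f)"
  then have "bounded (range (f \<circ> of_discrete))"
    by (rule bounded_subset) auto
  then have "f \<circ> of_discrete \<in> bcontfun"
    by (simp add: bcontfun_discrete_iff)
  then have "linf_apply (Bcontfun (f \<circ> of_discrete)) = f"
    by (simp add: fun_eq_iff linf_apply_def Bcontfun_inverse discrete_inverse)
  then show "f \<in> range linf_apply"
    by (metis rangeI)
qed

lemma norm_linf: "norm f = (SUP t. \<bar>linf_apply f t\<bar>)"
proof -
  have "range discrete = (UNIV :: 'a discrete set)"
    by (metis of_discrete_inverse surj_def)
  then have "range (\<lambda>x. \<bar>apply_bcontfun f x\<bar>) = range (\<lambda>t. \<bar>linf_apply f t\<bar>)"
    unfolding linf_apply_def by (metis image_image)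
  then show ?thesis
    by (simp add: norm_bcontfun_def dist_bcontfun_def zero_bcontfun.rep_eq)
qed

definition left_translate :: "'s::semigroup_mult \<Rightarrow> 's linf \<Rightarrow> 's linf"
  where "left_translate s f = Bcontfun (\<lambda>t. linf_apply f (s * of_discrete t))"

definition right_translate :: "'s::semigroup_mult \<Rightarrow> 's linf \<Rightarrow> 's linf"
  where "right_translate s f = Bcontfun (\<lambda>t. linf_apply f (of_discrete t * s))"

lemma bcontfun_linf_apply_comp: "(\<lambda>t. linf_apply f (p t)) \<in> bcontfun"
  for p :: "'t discrete \<Rightarrow> 's"
proof -
  have "bounded (range (linf_apply f))"
    using range_linf_apply by blast
  then have "bounded (range (\<lambda>t. linf_apply f (p t)))"
    by (rule bounded_subset) auto
  then show ?thesis
    by (simp add: bcontfun_discrete_iff)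
qed

lemma linf_apply_left_translate [simp]:
  "linf_apply (left_translate s f) t = linf_apply f (s * t)"
  unfolding left_translate_def linf_apply_def [of "Bcontfun _"]
  by (simp add: Bcontfun_inverse bcontfun_linf_apply_comp discrete_inverse)

lemma linf_apply_right_translate [simp]:
  "linf_apply (right_translate s f) t = linf_apply f (t * s)"
  unfolding right_translate_def linf_apply_def [of "Bcontfun _"]
  by (simp add: Bcontfun_inverse bcontfun_linf_apply_comp discrete_inverse)

lemma linf_apply_const [simp]: "linf_apply (const_bcontfun c) t = c"
  by (simp add: linf_apply_def const_bcontfun.rep_eq)

text \<open>
  Elements of the dual space of a subspace \<open>X\<close> are represented by functions on the whole space of
  which only the values on \<open>X\<close> matter.
\<close>

definition in_dual :: "'a::real_normed_vector set \<Rightarrow> ('a \<Rightarrow> real) \<Rightarrow> bool"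
  where "in_dual X \<mu> \<longleftrightarrow>
    (\<forall>f\<in>X. \<forall>g\<in>X. \<mu> (f + g) = \<mu> f + \<mu> g) \<and>
    (\<forall>c. \<forall>f\<in>X. \<mu> (c *\<^sub>R f) = c * \<mu> f) \<and>
    (\<exists>K. \<forall>f\<in>X. \<bar>\<mu> f\<bar> \<le> K * norm f)"

definition dual_norm :: "'a::real_normed_vector set \<Rightarrow> ('a \<Rightarrow> real) \<Rightarrow> real"
  where "dual_norm X \<mu> = (SUP f\<in>{f \<in> X. norm f \<le> 1}. \<bar>\<mu> f\<bar>)"

definition mean_on :: "'s linf set \<Rightarrow> ('s linf \<Rightarrow> real) \<Rightarrow> bool"
  where "mean_on X \<mu> \<longleftrightarrow>
    in_dual X \<mu> \<and> dual_norm X \<mu> = 1 \<and> \<mu> (const_bcontfun 1) = 1"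

definition left_invariant_on :: "'s::semigroup_mult linf set \<Rightarrow> ('s linf \<Rightarrow> real) \<Rightarrow> bool"
  where "left_invariant_on X \<mu> \<longleftrightarrow> (\<forall>s. \<forall>f\<in>X. \<mu> (left_translate s f) = \<mu> f)"

definition left_amenable :: "'s::semigroup_mult linf set \<Rightarrow> bool"
  where "left_amenable X \<longleftrightarrow> (\<exists>\<mu>. mean_on X \<mu> \<and> left_invariant_on X \<mu>)"

definition uniformly_lipschitzian_semigroup ::
    "real \<Rightarrow> 'h::real_normed_vector set \<Rightarrow> ('s::semigroup_mult \<Rightarrow> 'h \<Rightarrow> 'h) \<Rightarrow> bool"
  where "uniformly_lipschitzian_semigroup k C T \<longleftrightarrow>
    (\<forall>t. T t \<in> C \<rightarrow> C) \<and>
    (\<forall>t s. \<forall>x\<in>C. T (t * s) x = T t (T s x)) \<and>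
    (\<forall>t. \<forall>x\<in>C. \<forall>y\<in>C. norm (T t x - T t y) \<le> k * norm (x - y))"

definition Fix :: "'h set \<Rightarrow> ('s \<Rightarrow> 'h \<Rightarrow> 'h) \<Rightarrow> 'h set"
  where "Fix C T = (\<Inter>t. {x \<in> C. T t x = x})"

definition hoelder_continuous_on ::
    "'a::real_normed_vector set \<Rightarrow> ('a \<Rightarrow> 'b::real_normed_vector) \<Rightarrow> bool"
  where "hoelder_continuous_on C R \<longleftrightarrow>
    (\<exists>M \<alpha>. 0 \<le> M \<and> 0 < \<alpha> \<and> \<alpha> \<le> 1 \<and>
      (\<forall>x\<in>C. \<forall>y\<in>C. norm (R x - R y) \<le> M * norm (x - y) powr \<alpha>))"

definition hoelder_retract_of :: "'a::real_normed_vector set \<Rightarrow> 'a set \<Rightarrow> bool"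
  where "hoelder_retract_of F C \<longleftrightarrow>
    F \<subseteq> C \<and> (\<exists>R. R \<in> C \<rightarrow> F \<and> (\<forall>x\<in>F. R x = x) \<and> hoelder_continuous_on C R)"

end

theory Submission
  imports Defs
begin

text \<open>
  Enlarging \<open>k\<close> if necessary, let \<open>1 < k < \<surd>2\<close>, and let \<open>\<mu>\<close> be a left invariant mean. The mean square distance
  \<open>\<phi> x y = \<mu>\<^sub>t \<parallel>T\<^sub>t x - y\<parallel>\<^sup>2\<close> of \<open>y\<close> from the orbit of \<open>x\<close> is, in a Hilbert space, a quadratic
  function of \<open>y\<close> with leading part \<open>\<parallel>y\<parallel>\<^sup>2\<close>. It therefore has a minimiser \<open>Px\<close> in \<open>C\<close>, the
  asymptotic centre of the orbit, and grows quadratically away from it: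
  \<open>\<phi> x (Px) + \<parallel>y - Px\<parallel>\<^sup>2 \<le> \<phi> x y\<close> for \<open>y\<close> in \<open>C\<close> (\<open>strongly_convex_has_minimizer\<close>).

  Left invariance allows replacing \<open>T\<^sub>t x\<close> by \<open>T\<^sub>s T\<^sub>t x\<close> under the mean, so
  \<open>\<phi> x (T\<^sub>s Px) \<le> k\<^sup>2 \<phi> x (Px)\<close>. Compared with the quadratic growth at \<open>y = T\<^sub>s Px\<close> this says that
  every \<open>T\<^sub>s\<close> moves \<open>Px\<close> by at most the square root of \<open>(k\<^sup>2 - 1) r(x)\<close>, where \<open>r(x) = \<phi> x (Px)\<close>
  (\<open>displacement_centre\<close>). Averaging over \<open>s\<close> gives \<open>r(Px) \<le> (k\<^sup>2 - 1) r(x)\<close>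
  (\<open>radius_centre\<close>), and \<open>k\<^sup>2 - 1 < 1\<close> is precisely \<open>k < \<surd>2\<close>. Hence the iterates
  \<open>P\<^sup>n x\<close> converge geometrically, and since the displacements tend to \<open>0\<close> their limit \<open>R x\<close> is a
  common fixed point. The orbit of a common fixed point is constant, so \<open>P\<close> and \<open>R\<close> leave it in place.

  The map \<open>P\<close> is again \<open>k\<close>-Lipschitzian (\<open>centre_lipschitz\<close>), so with \<open>q = \<surd>(k\<^sup>2 - 1)\<close>
  one has \<open>\<parallel>R x - R y\<parallel> \<le> A q\<^sup>n + k\<^sup>n \<parallel>x - y\<parallel>\<close> for every \<open>n\<close>. The first term decays and the second
  grows geometrically; balancing them by the choice of \<open>n\<close> yields a power of \<open>\<parallel>x - y\<parallel>\<close>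
  (\<open>geometric_tradeoff_powr_bound\<close>), which is the Hoelder estimate.
\<close>

section \<open>Geometric rates and Hoelder exponents\<close>

text \<open>
  Put \<open>\<rho> = q / K\<close>. For \<open>0 < d < 1\<close>, if \<open>\<rho>\<^sup>n\<close> is the last power that is at least \<open>d\<close>, both terms of the
  hypothesis are at most a multiple of \<open>q\<^sup>n\<close>; and \<open>q = \<rho>\<^sup>\<alpha>\<close> for \<open>\<alpha> = ln q / ln \<rho>\<close>, so that
  \<open>q\<^sup>n\<close> is comparable to \<open>d\<^sup>\<alpha>\<close>. The bound \<open>B\<close> is what makes \<open>d \<ge> 1\<close> harmless, as \<open>n = 0\<close> then gives
  a constant and \<open>d\<^sup>\<alpha> \<ge> 1\<close>.
\<close>

lemma geometric_tradeoff_powr_bound: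
  fixes q K A B :: real
  assumes q: "0 < q" "q < 1" and K: "1 < K" and A: "0 \<le> A" and B: "0 \<le> B"
  obtains M \<alpha> where "0 \<le> M" "0 < \<alpha>" "\<alpha> \<le> 1"
    "\<And>a d. \<lbrakk>0 \<le> d; d \<le> B; \<And>n. a \<le> A * q ^ n + K ^ n * d\<rbrakk> \<Longrightarrow> a \<le> M * d powr \<alpha>"
proof -
  define \<rho> where "\<rho> = q / K"
  define \<alpha> where "\<alpha> = ln q / ln \<rho>"
  define M where "M = (A + 1) / q + A + B"
  have \<rho>: "0 < \<rho>" "\<rho> < 1" "\<rho> < q"
    using q K by (auto simp: \<rho>_def field_simps intro: less_trans)
  have ln: "ln \<rho> < ln q" "ln q < 0"
    using q \<rho> by auto
  have \<alpha>: "0 < \<alpha>" "\<alpha> \<le> 1"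
    using ln by (auto simp: \<alpha>_def field_simps)
  have \<rho>\<alpha>: "\<rho> powr \<alpha> = q"
    using ln \<rho> q by (simp add: powr_def \<alpha>_def)
  have M: "0 \<le> M"
    using A B q by (simp add: M_def)
  have bound: "a \<le> M * d powr \<alpha>"
    if d: "0 \<le> d" "d \<le> B" and a: "\<And>n. a \<le> A * q ^ n + K ^ n * d" for a d
  proof -
    consider "d = 0" | "1 \<le> d" | "0 < d" "d < 1"
      using d by linarith
    then show ?thesis
    proof cases
      case 1
      have "(\<lambda>n. A * q ^ n) \<longlonglongrightarrow> A * 0"
        using q by (intro tendsto_mult_left LIMSEQ_power_zero) auto
      then have "a \<le> A * 0"
        by (rule LIMSEQ_le_const) (use a 1 in auto)
      then show ?thesis
        using 1 by simp
    next
      case 2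
      have "a \<le> A + B"
        using a[of 0] d by simp
      also have "\<dots> \<le> M"
        using A q by (simp add: M_def)
      also have "\<dots> \<le> M * d powr \<alpha>"
        using mult_left_mono[OF ge_one_powr_ge_zero[of d \<alpha>] M] 2 \<alpha> by simp
      finally show ?thesis .
    next
      case 3
      have ex: "\<exists>N. \<rho> ^ N < d"
        using real_arch_pow_inv[OF 3(1) \<rho>(2)] .
      define N where "N = (LEAST N. \<rho> ^ N < d)"
      have N: "\<rho> ^ N < d"
        unfolding N_def using ex by (rule LeastI_ex)
      have "N \<noteq> 0"
        using N 3 by (intro notI) simp
      then obtain n where n: "N = Suc n"
        using not0_implies_Suc by blast
      have "\<not> \<rho> ^ n < d"
        using not_less_Least[of n "\<lambda>N. \<rho> ^ N < d"] n by (simp add: N_def)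
      then have "K ^ n * d \<le> K ^ n * \<rho> ^ n"
        using K by simp
      also have "\<dots> = q ^ n"
        using K by (simp add: \<rho>_def power_divide)
      finally have "a \<le> (A + 1) * q ^ n"
        using a[of n] by (simp add: algebra_simps)
      also have "\<dots> = (A + 1) / q * q ^ N"
        using q n by simp
      also have "q ^ N = (\<rho> ^ N) powr \<alpha>"
        using \<rho> by (simp add: \<rho>\<alpha>[symmetric] powr_realpow[symmetric] powr_powr mult.commute)
      also have "(A + 1) / q * (\<rho> ^ N) powr \<alpha> \<le> (A + 1) / q * d powr \<alpha>"
        using N \<rho> \<alpha> A q by (intro mult_left_mono powr_mono2) auto
      also have "\<dots> \<le> M * d powr \<alpha>"
        using A B by (intro mult_right_mono) (auto simp: M_def)
      finally show ?thesis .
    qed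
  qed
  show ?thesis
    using that[OF M \<alpha> bound] by blast
qed

lemma geometric_steps_limit:
  fixes u :: "nat \<Rightarrow> 'a::{real_normed_vector, complete_space}"
  assumes q: "0 \<le> q" "q < 1" and step: "\<And>n. norm (u (Suc n) - u n) \<le> D * q ^ n"
  obtains L where "u \<longlonglongrightarrow> L" "\<And>n. norm (L - u n) \<le> D / (1 - q) * q ^ n"
proof -
  have D: "0 \<le> D"
    using order_trans[OF norm_ge_zero step[of 0]] by simp
  have tail: "norm (u (n + m) - u n) \<le> D / (1 - q) * (q ^ n - q ^ (n + m))" for n m
  proof (induction m)
    case 0
    show ?case by simp
  next
    case (Suc m)
    have "norm (u (n + Suc m) - u n) \<le> norm (u (Suc (n + m)) - u (n + m)) + norm (u (n + m) - u n)"
      using norm_triangle_ineq[of "u (Suc (n + m)) - u (n + m)" "u (n + m) - u n"] by simp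
    also have "\<dots> \<le> D * q ^ (n + m) + D / (1 - q) * (q ^ n - q ^ (n + m))"
      using step Suc.IH by (intro add_mono)
    also have "\<dots> = D / (1 - q) * (q ^ n - q ^ (n + Suc m))"
      using q by (simp add: field_simps)
    finally show ?case .
  qed
  have tail': "norm (u m - u n) \<le> D / (1 - q) * q ^ n" if "n \<le> m" for n m
  proof -
    have "norm (u m - u n) \<le> D / (1 - q) * (q ^ n - q ^ m)"
      using tail[of n "m - n"] that by simp
    also have "\<dots> \<le> D / (1 - q) * q ^ n"
      using q D by (intro mult_left_mono) auto
    finally show ?thesis .
  qed
  have lim: "(\<lambda>n. D / (1 - q) * q ^ n) \<longlonglongrightarrow> 0"
    using q tendsto_mult_right_zero LIMSEQ_power_zero[of q] by fastforce
  have "Cauchy u"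
  proof (rule metric_CauchyI)
    fix e :: real
    assume "0 < e"
    with lim have "\<forall>\<^sub>F n in sequentially. D / (1 - q) * q ^ n < e / 2"
      by (intro order_tendstoD) auto
    then obtain n where n: "D / (1 - q) * q ^ n < e / 2"
      by (auto simp: eventually_sequentially)
    show "\<exists>M. \<forall>m\<ge>M. \<forall>n\<ge>M. dist (u m) (u n) < e"
    proof (intro exI allI impI)
      fix i j
      assume "n \<le> i" "n \<le> j"
      then have "dist (u i) (u n) < e / 2" "dist (u j) (u n) < e / 2"
        using tail' n unfolding dist_norm by (blast intro: le_less_trans)+
      then show "dist (u i) (u j) < e"
        by (rule dist_triangle_half_l)
    qed
  qed
  then obtain L where L: "u \<longlonglongrightarrow> L"
    using Cauchy_convergent convergent_def by blast
  moreover have "norm (L - u n) \<le> D / (1 - q) * q ^ n" for n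
  proof (rule Lim_norm_ubound)
    show "(\<lambda>m. u m - u n) \<longlonglongrightarrow> L - u n"
      using L by (intro tendsto_intros)
    show "\<forall>\<^sub>F m in sequentially. norm (u m - u n) \<le> D / (1 - q) * q ^ n"
      using tail' by (auto simp: eventually_sequentially)
  qed simp
  ultimately show ?thesis
    using that by blast
qed

section \<open>Minimisers of strongly convex functions\<close>

text \<open>
  Strong convexity at midpoints makes any minimising sequence Cauchy. Comparing the minimum with
  nearby points of the segment towards \<open>y\<close> then turns minimality into quadratic growth.
\<close>

lemma strongly_convex_has_minimizer:
  fixes C :: "'a::{real_normed_vector, complete_space} set" and \<phi> :: "'a \<Rightarrow> real"
  assumes C: "C \<noteq> {}" "closed C" "convex C"
    and cont: "continuous_on C \<phi>"
    and lower: "\<And>y. y \<in> C \<Longrightarrow> b \<le> \<phi> y"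
    and strong: "\<And>y z s. \<lbrakk>y \<in> C; z \<in> C; 0 \<le> s; s \<le> 1\<rbrakk> \<Longrightarrow>
      \<phi> ((1 - s) *\<^sub>R y + s *\<^sub>R z) \<le> (1 - s) * \<phi> y + s * \<phi> z - s * (1 - s) * (norm (y - z))\<^sup>2"
  obtains p where "p \<in> C" "\<And>y. y \<in> C \<Longrightarrow> \<phi> p + (norm (y - p))\<^sup>2 \<le> \<phi> y"
proof -
  define r where "r = Inf (\<phi> ` C)"
  have bdd: "bdd_below (\<phi> ` C)"
    using lower by (auto simp: bdd_below_def)
  have r: "r \<le> \<phi> y" if "y \<in> C" for y
    unfolding r_def using bdd that by (rule cINF_lower)
  have "\<exists>y\<in>C. \<phi> y < r + inverse (real (Suc n))" for n
    using cINF_less_iff[OF C(1) bdd, of "r + inverse (real (Suc n))"] by (simp add: r_def)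
  then obtain u where u: "\<And>n. u n \<in> C" "\<And>n. \<phi> (u n) < r + inverse (real (Suc n))"
    by metis
  have close: "(norm (y - z))\<^sup>2 \<le> 2 * (\<phi> y - r) + 2 * (\<phi> z - r)" if "y \<in> C" "z \<in> C" for y z
  proof -
    have "r \<le> \<phi> ((1 - 1/2) *\<^sub>R y + (1/2) *\<^sub>R z)"
      using that C by (intro r convexD) auto
    also have "\<dots> \<le> \<phi> y / 2 + \<phi> z / 2 - (norm (y - z))\<^sup>2 / 4"
      using strong[OF that, of "1/2"] by simp
    finally show ?thesis by simp
  qed
  have "Cauchy u"
  proof (rule metric_CauchyI)
    fix e :: real
    assume e: "0 < e"
    then obtain N where N: "inverse (real (Suc N)) < e\<^sup>2 / 4"
      using reals_Archimedean[of "e\<^sup>2 / 4"] by auto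
    have small: "\<phi> (u n) - r < e\<^sup>2 / 4" if "N \<le> n" for n
    proof -
      have "inverse (real (Suc n)) \<le> inverse (real (Suc N))"
        using that by (intro le_imp_inverse_le) auto
      then show ?thesis
        using u(2)[of n] N by linarith
    qed
    show "\<exists>M. \<forall>m\<ge>M. \<forall>n\<ge>M. dist (u m) (u n) < e"
    proof (intro exI allI impI)
      fix m n
      assume mn: "N \<le> m" "N \<le> n"
      have "(norm (u m - u n))\<^sup>2 < e\<^sup>2"
        using close[OF u(1) u(1), of m n] small[OF mn(1)] small[OF mn(2)] by argo
      then show "dist (u m) (u n) < e"
        using e by (simp add: dist_norm power_less_imp_less_base)
    qed
  qed
  then obtain p where p: "u \<longlonglongrightarrow> p"
    using Cauchy_convergent convergent_def by blast
  have pC: "p \<in> C"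
    using closed_sequentially[OF C(2)] u(1) p by blast
  have "(\<lambda>n. \<phi> (u n)) \<longlonglongrightarrow> \<phi> p"
    using continuous_on_tendsto_compose[OF cont p pC] u(1) by simp
  moreover have "(\<lambda>n. r + inverse (real (Suc n))) \<longlonglongrightarrow> r"
    using LIMSEQ_inverse_real_of_nat_add[of r] by simp
  ultimately have "\<phi> p \<le> r"
    by (rule LIMSEQ_le) (use u(2) in \<open>auto intro: less_imp_le\<close>)
  have "\<phi> p + (norm (y - p))\<^sup>2 \<le> \<phi> y" if y: "y \<in> C" for y
  proof -
    have "(1 - s) * (norm (p - y))\<^sup>2 \<le> \<phi> y - \<phi> p" if s: "0 < s" "s < 1" for s
    proof -
      have "\<phi> p \<le> \<phi> ((1 - s) *\<^sub>R p + s *\<^sub>R y)"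
        using \<open>\<phi> p \<le> r\<close> pC y s C by (intro order_trans[OF _ r] convexD) auto
      also have "\<dots> \<le> (1 - s) * \<phi> p + s * \<phi> y - s * (1 - s) * (norm (p - y))\<^sup>2"
        using s by (intro strong pC y) auto
      finally have "s * ((1 - s) * (norm (p - y))\<^sup>2) \<le> s * (\<phi> y - \<phi> p)"
        by (simp add: algebra_simps)
      then show ?thesis
        using s by simp
    qed
    then have "\<forall>\<^sub>F s in at_right 0. (1 - s) * (norm (p - y))\<^sup>2 \<le> \<phi> y - \<phi> p"
      by (intro eventually_at_rightI[of 0 1]) auto
    moreover have "((\<lambda>s. (1 - s) * (norm (p - y))\<^sup>2) \<longlongrightarrow> (norm (p - y))\<^sup>2) (at_right 0)"
      by (auto intro!: tendsto_eq_intros)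
    ultimately have "(norm (p - y))\<^sup>2 \<le> \<phi> y - \<phi> p"
      by (intro tendsto_upperbound) auto
    then show ?thesis
      by (simp add: norm_minus_commute)
  qed
  with pC show ?thesis
    using that by blast
qed

lemma norm_diff_convex_combination_square:
  fixes a y z :: "'a::real_inner"
  shows "(norm (a - ((1 - s) *\<^sub>R y + s *\<^sub>R z)))\<^sup>2 =
    (1 - s) * (norm (a - y))\<^sup>2 + s * (norm (a - z))\<^sup>2 - s * (1 - s) * (norm (y - z))\<^sup>2"
proof -
  define v w where "v = a - y" and "w = a - z"
  have eqs: "a - ((1 - s) *\<^sub>R y + s *\<^sub>R z) = (1 - s) *\<^sub>R v + s *\<^sub>R w" "y - z = w - v"
    by (simp_all add: v_def w_def algebra_simps)
  show ?thesis
    unfolding eqs v_def[symmetric] w_def[symmetric] power2_norm_eq_inner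
    by (simp add: inner_add_left inner_add_right inner_diff_left inner_diff_right
        inner_commute[of w v] algebra_simps)
qed

lemma norm_square_mixed_difference:
  fixes a b p r :: "'a::real_inner"
  shows "((norm (a - r))\<^sup>2 - (norm (a - p))\<^sup>2) - ((norm (b - r))\<^sup>2 - (norm (b - p))\<^sup>2) =
    2 * ((a - b) \<bullet> (p - r))"
  by (simp add: power2_norm_eq_inner inner_add_left inner_add_right inner_diff_left
      inner_diff_right inner_commute)

section \<open>Left invariant means on spaces of functions\<close>

lemma linf_apply_simps [simp]:
  "linf_apply (f + g) t = linf_apply f t + linf_apply g t"
  "linf_apply (c *\<^sub>R f) t = c * linf_apply f t"
  by (simp_all add: linf_apply_def plus_bcontfun.rep_eq scaleR_bcontfun.rep_eq)

lemma inj_linf_apply: "inj linf_apply"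
proof (rule injI)
  fix f g :: "'a linf"
  assume eq: "linf_apply f = linf_apply g"
  show "f = g"
  proof (rule bcontfun_eqI)
    fix x
    show "apply_bcontfun f x = apply_bcontfun g x"
      using fun_cong[OF eq, of "of_discrete x"] by (simp add: linf_apply_def of_discrete_inverse)
  qed
qed

lemma abs_linf_apply_le_norm: "\<bar>linf_apply f t\<bar> \<le> norm f"
  using norm_bounded[of f "discrete t"] by (simp add: linf_apply_def)

lemma norm_linf_le: "(\<And>t. \<bar>linf_apply f t\<bar> \<le> c) \<Longrightarrow> norm f \<le> c"
  unfolding norm_linf by (rule cSUP_least) auto

lemma mean_on_le_norm:
  assumes mean: "mean_on X \<mu>" and X: "subspace X" and f: "f \<in> X"
  shows "\<bar>\<mu> f\<bar> \<le> norm f"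
proof -
  let ?B = "{f \<in> X. norm f \<le> 1}"
  have scale: "\<mu> (c *\<^sub>R f) = c * \<mu> f" if "f \<in> X" for c f
    using mean that by (auto simp: mean_on_def in_dual_def)
  obtain K where K: "\<And>f. f \<in> X \<Longrightarrow> \<bar>\<mu> f\<bar> \<le> K * norm f"
    using mean unfolding mean_on_def in_dual_def by blast
  have bdd: "bdd_above ((\<lambda>f. \<bar>\<mu> f\<bar>) ` ?B)"
  proof (rule bdd_aboveI2)
    fix f
    assume f: "f \<in> ?B"
    have "\<bar>\<mu> f\<bar> \<le> K * norm f"
      using K f by simp
    also have "\<dots> \<le> \<bar>K\<bar> * norm f"
      by (intro mult_right_mono) auto
    also have "\<dots> \<le> \<bar>K\<bar> * 1"
      using f by (intro mult_left_mono) auto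
    finally show "\<bar>\<mu> f\<bar> \<le> \<bar>K\<bar>" by simp
  qed
  show ?thesis
  proof (cases "f = 0")
    case True
    then show ?thesis
      using scale[OF f, of 0] by simp
  next
    case False
    define g where "g = inverse (norm f) *\<^sub>R f"
    have "g \<in> ?B"
      using X f False by (simp add: g_def subspace_scale)
    then have "\<bar>\<mu> g\<bar> \<le> dual_norm X \<mu>"
      unfolding dual_norm_def using bdd by (rule cSUP_upper)
    then have "inverse (norm f) * \<bar>\<mu> f\<bar> \<le> 1"
      using mean scale[OF f] by (simp add: g_def mean_on_def abs_mult)
    then show ?thesis
      using False by (simp add: field_simps)
  qed
qed

text \<open>
  The norm condition on a mean bounds the deviation from \<open>0\<close> only symmetrically. Adding a large
  constant moves all values of \<open>f\<close> into an interval \<open>[0, b + c]\<close>, where the symmetric bound is sharp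
  from above.
\<close>

lemma mean_on_le_upper_bound:
  assumes mean: "mean_on X \<mu>" and X: "subspace X" and one: "const_bcontfun 1 \<in> X"
    and f: "f \<in> X" and le: "\<And>t. linf_apply f t \<le> b"
  shows "\<mu> f \<le> b"
proof -
  define c where "c = norm f + \<bar>b\<bar>"
  have cX: "c *\<^sub>R const_bcontfun 1 \<in> X"
    using X one by (rule subspace_scale)
  have "\<mu> (f + c *\<^sub>R const_bcontfun 1) = \<mu> f + c"
    using mean one f cX by (simp add: mean_on_def in_dual_def)
  moreover have "norm (f + c *\<^sub>R const_bcontfun 1) \<le> b + c"
  proof (rule norm_linf_le)
    fix t
    show "\<bar>linf_apply (f + c *\<^sub>R const_bcontfun 1) t\<bar> \<le> b + c"
      using abs_linf_apply_le_norm[of f t] le[of t] unfolding linf_apply_simps linf_apply_const c_def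
      by argo
  qed
  moreover have "\<bar>\<mu> (f + c *\<^sub>R const_bcontfun 1)\<bar> \<le> norm (f + c *\<^sub>R const_bcontfun 1)"
    using mean X by (rule mean_on_le_norm) (use X f cX in \<open>simp add: subspace_add\<close>)
  ultimately show ?thesis by linarith
qed

text \<open>
  A left invariant mean seen as a functional on plain functions. The constant upper bounds
  characterise positivity, because the functional is linear.
\<close>

locale left_invariant_mean =
  fixes V :: "('s::semigroup_mult \<Rightarrow> real) set" and \<Lambda> :: "('s \<Rightarrow> real) \<Rightarrow> real"
  assumes add_in: "\<lbrakk>f \<in> V; g \<in> V\<rbrakk> \<Longrightarrow> (\<lambda>t. f t + g t) \<in> V"
    and scale_in: "f \<in> V \<Longrightarrow> (\<lambda>t. c * f t) \<in> V"
    and const_in: "(\<lambda>t. c) \<in> V"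
    and translate_in: "f \<in> V \<Longrightarrow> (\<lambda>t. f (s * t)) \<in> V"
    and mean_add: "\<lbrakk>f \<in> V; g \<in> V\<rbrakk> \<Longrightarrow> \<Lambda> (\<lambda>t. f t + g t) = \<Lambda> f + \<Lambda> g"
    and mean_scale: "f \<in> V \<Longrightarrow> \<Lambda> (\<lambda>t. c * f t) = c * \<Lambda> f"
    and mean_const: "\<Lambda> (\<lambda>t. c) = c"
    and mean_le: "\<lbrakk>f \<in> V; \<And>t. f t \<le> b\<rbrakk> \<Longrightarrow> \<Lambda> f \<le> b"
    and mean_translate: "f \<in> V \<Longrightarrow> \<Lambda> (\<lambda>t. f (s * t)) = \<Lambda> f"
begin

lemma diff_in: "\<lbrakk>f \<in> V; g \<in> V\<rbrakk> \<Longrightarrow> (\<lambda>t. f t - g t) \<in> V"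
  using add_in[OF _ scale_in[of g "-1"], of f] by simp

lemma mean_diff: "\<lbrakk>f \<in> V; g \<in> V\<rbrakk> \<Longrightarrow> \<Lambda> (\<lambda>t. f t - g t) = \<Lambda> f - \<Lambda> g"
  using mean_add[OF _ scale_in[of g "-1"], of f] mean_scale[of g "-1"] by simp

lemma mean_mono: "\<lbrakk>f \<in> V; g \<in> V; \<And>t. f t \<le> g t\<rbrakk> \<Longrightarrow> \<Lambda> f \<le> \<Lambda> g"
  using mean_le[OF diff_in[of f g], of 0] mean_diff[of f g] by simp

end

lemma left_invariant_mean_of_left_amenable:
  fixes X :: "'s::semigroup_mult linf set"
  assumes X: "subspace X" and one: "const_bcontfun 1 \<in> X"
    and left: "\<And>s. left_translate s ` X \<subseteq> X" and "left_amenable X"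
  obtains \<Lambda> where "left_invariant_mean (linf_apply ` X) \<Lambda>"
proof -
  obtain \<mu> where mean: "mean_on X \<mu>" and inv: "left_invariant_on X \<mu>"
    using \<open>left_amenable X\<close> by (auto simp: left_amenable_def)
  define \<Lambda> where "\<Lambda> f = \<mu> (inv linf_apply f)" for f
  have \<Lambda>: "\<Lambda> (linf_apply f) = \<mu> f" for f
    by (simp add: \<Lambda>_def inj_linf_apply)
  have sum: "(\<lambda>t. linf_apply f t + linf_apply g t) = linf_apply (f + g)" for f g :: "'s linf"
    by (simp add: fun_eq_iff)
  have scale: "(\<lambda>t. c * linf_apply f t) = linf_apply (c *\<^sub>R f)" for c and f :: "'s linf"
    by (simp add: fun_eq_iff)
  have const: "(\<lambda>t. c) = linf_apply (c *\<^sub>R const_bcontfun 1 :: 's linf)" for c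
    by (simp add: fun_eq_iff)
  have translate: "(\<lambda>t. linf_apply f (s * t)) = linf_apply (left_translate s f)" for s f
    by (simp add: fun_eq_iff)
  have "left_invariant_mean (linf_apply ` X) \<Lambda>"
  proof (unfold_locales, goal_cases)
    case (1 f g)
    then show ?case using X by (auto simp: sum subspace_add)
  next
    case (2 f c)
    then show ?case using X by (auto simp: scale subspace_scale)
  next
    case (3 c)
    show ?case unfolding const using X one by (intro imageI subspace_scale)
  next
    case (4 f s)
    then show ?case using left[of s] by (auto simp: translate)
  next
    case (5 f g)
    then show ?case using mean by (auto simp: sum \<Lambda> mean_on_def in_dual_def)
  next
    case (6 f c)
    then show ?case using mean by (auto simp: scale \<Lambda> mean_on_def in_dual_def)
  next
    case (7 c)
    show ?case unfolding const \<Lambda> using mean one by (auto simp: mean_on_def in_dual_def)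
  next
    case (8 f b)
    then show ?case using mean_on_le_upper_bound[OF mean X one] by (auto simp: \<Lambda>)
  next
    case (9 f s)
    then show ?case using inv by (auto simp: translate \<Lambda> left_invariant_on_def)
  qed
  then show ?thesis
    using that by blast
qed

section \<open>Asymptotic centres of orbits\<close>

text \<open>
  Taking the Lipschitz constant larger than \<open>1\<close> loses nothing and keeps the contraction factor
  \<open>K\<^sup>2 - 1\<close> positive.
\<close>

locale lipschitzian_semigroup_with_mean = left_invariant_mean V \<Lambda>
  for V :: "('s::semigroup_mult \<Rightarrow> real) set" and \<Lambda> +
  fixes C :: "'h::{real_inner, complete_space} set" and T :: "'s \<Rightarrow> 'h \<Rightarrow> 'h" and K :: real
  assumes C_nonempty: "C \<noteq> {}" and C_bounded: "bounded C"
    and C_closed: "closed C" and C_convex: "convex C"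
    and semigroup: "uniformly_lipschitzian_semigroup K C T"
    and dist_square_in: "x \<in> C \<Longrightarrow> (\<lambda>t. (norm (T t x - y))\<^sup>2) \<in> V"
    and K_gt_1: "1 < K" and K_square_less_2: "K\<^sup>2 < 2"
begin

lemma T_in: "x \<in> C \<Longrightarrow> T t x \<in> C"
  and T_mult: "x \<in> C \<Longrightarrow> T (t * s) x = T t (T s x)"
  and T_lipschitz: "\<lbrakk>x \<in> C; y \<in> C\<rbrakk> \<Longrightarrow> norm (T t x - T t y) \<le> K * norm (x - y)"
  using semigroup by (auto simp: uniformly_lipschitzian_semigroup_def)

definition mean_square_dist :: "'h \<Rightarrow> 'h \<Rightarrow> real"
  where "mean_square_dist x y = \<Lambda> (\<lambda>t. (norm (T t x - y))\<^sup>2)"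

lemma mean_square_dist_nonneg: "x \<in> C \<Longrightarrow> 0 \<le> mean_square_dist x y"
  using mean_mono[OF const_in dist_square_in[of x y], of 0] by (simp add: mean_square_dist_def mean_const)

lemma mean_square_dist_le:
  "\<lbrakk>x \<in> C; \<And>t. (norm (T t x - y))\<^sup>2 \<le> b\<rbrakk> \<Longrightarrow> mean_square_dist x y \<le> b"
  unfolding mean_square_dist_def by (rule mean_le[OF dist_square_in])

lemma norm_diff_le_diameter: "\<lbrakk>x \<in> C; y \<in> C\<rbrakk> \<Longrightarrow> norm (x - y) \<le> diameter C"
  using diameter_bounded_bound[OF C_bounded] by (simp add: dist_norm)

lemma diameter_C_nonneg: "0 \<le> diameter C"
  using C_bounded by (rule diameter_ge_0)

lemma mean_square_dist_convex_combination:
  assumes x: "x \<in> C"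
  shows "mean_square_dist x ((1 - s) *\<^sub>R y + s *\<^sub>R z) =
    (1 - s) * mean_square_dist x y + s * mean_square_dist x z - s * (1 - s) * (norm (y - z))\<^sup>2"
  unfolding mean_square_dist_def norm_diff_convex_combination_square
  by (simp add: mean_diff mean_add mean_scale mean_const add_in scale_in const_in
      dist_square_in[OF x])

lemma mean_square_dist_lipschitz:
  assumes x: "x \<in> C" and y: "y \<in> C" and z: "z \<in> C"
  shows "mean_square_dist x y - mean_square_dist x z \<le> 2 * diameter C * norm (y - z)"
proof -
  have "(norm (T t x - y))\<^sup>2 - (norm (T t x - z))\<^sup>2 \<le> 2 * diameter C * norm (y - z)" for t
  proof -
    let ?a = "norm (T t x - y)" and ?b = "norm (T t x - z)"
    have ab: "?a - ?b \<le> norm (y - z)"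
      using norm_triangle_ineq2[of "T t x - y" "T t x - z"] by (simp add: norm_minus_commute)
    have "?a\<^sup>2 - ?b\<^sup>2 = (?a + ?b) * (?a - ?b)"
      by (simp add: power2_eq_square algebra_simps)
    also have "\<dots> \<le> (?a + ?b) * norm (y - z)"
      using ab by (intro mult_left_mono) auto
    also have "\<dots> \<le> (2 * diameter C) * norm (y - z)"
      using add_mono[OF norm_diff_le_diameter[OF T_in[OF x] y] norm_diff_le_diameter[OF T_in[OF x] z]]
      by (intro mult_right_mono) auto
    finally show ?thesis .
  qed
  then have "\<Lambda> (\<lambda>t. (norm (T t x - y))\<^sup>2 - (norm (T t x - z))\<^sup>2) \<le> 2 * diameter C * norm (y - z)"
    using x by (intro mean_le diff_in dist_square_in)
  then show ?thesis
    using x by (simp add: mean_square_dist_def mean_diff dist_square_in)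
qed

lemma continuous_on_mean_square_dist:
  assumes x: "x \<in> C"
  shows "continuous_on C (mean_square_dist x)"
proof (rule lipschitz_on_continuous_on[OF lipschitz_onI])
  fix y z
  assume "y \<in> C" "z \<in> C"
  then show "dist (mean_square_dist x y) (mean_square_dist x z) \<le> 2 * diameter C * dist y z"
    using mean_square_dist_lipschitz[OF x, of y z] mean_square_dist_lipschitz[OF x, of z y]
    by (simp add: dist_norm norm_minus_commute abs_le_iff)
qed (use diameter_C_nonneg in simp)

definition centre :: "'h \<Rightarrow> 'h"
  where "centre x = (SOME p. p \<in> C \<and>
    (\<forall>y\<in>C. mean_square_dist x p + (norm (y - p))\<^sup>2 \<le> mean_square_dist x y))"

definition radius :: "'h \<Rightarrow> real"
  where "radius x = mean_square_dist x (centre x)"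

lemma
  assumes x: "x \<in> C"
  shows centre_in: "centre x \<in> C"
    and radius_add_le: "y \<in> C \<Longrightarrow> radius x + (norm (y - centre x))\<^sup>2 \<le> mean_square_dist x y"
proof -
  obtain p where "p \<in> C" "\<And>y. y \<in> C \<Longrightarrow> mean_square_dist x p + (norm (y - p))\<^sup>2 \<le> mean_square_dist x y"
  proof (rule strongly_convex_has_minimizer[OF C_nonempty C_closed C_convex
        continuous_on_mean_square_dist[OF x]])
    show "0 \<le> mean_square_dist x y" for y
      using x by (rule mean_square_dist_nonneg)
  qed (simp_all add: mean_square_dist_convex_combination[OF x])
  then have ex: "\<exists>p. p \<in> C \<and>
      (\<forall>y\<in>C. mean_square_dist x p + (norm (y - p))\<^sup>2 \<le> mean_square_dist x y)"
    by blast
  have "centre x \<in> C \<and>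
      (\<forall>y\<in>C. mean_square_dist x (centre x) + (norm (y - centre x))\<^sup>2 \<le> mean_square_dist x y)"
    unfolding centre_def by (fact someI_ex[OF ex])
  then show "centre x \<in> C"
    and "y \<in> C \<Longrightarrow> radius x + (norm (y - centre x))\<^sup>2 \<le> mean_square_dist x y"
    by (auto simp: radius_def)
qed

lemma radius_nonneg: "x \<in> C \<Longrightarrow> 0 \<le> radius x"
  unfolding radius_def by (rule mean_square_dist_nonneg)

lemma radius_le_diameter_square:
  assumes "x \<in> C"
  shows "radius x \<le> (diameter C)\<^sup>2"
  unfolding radius_def
  using assms by (intro mean_square_dist_le power_mono norm_diff_le_diameter T_in centre_in) auto

text \<open>
  Under the invariant mean the orbit of \<open>x\<close> may be replaced by its image under \<open>T s\<close>, so moving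
  the centre by \<open>T s\<close> increases the mean square distance at most by the factor \<open>K\<^sup>2\<close>. Quadratic growth
  converts the excess over the minimum into a bound for the distance moved.
\<close>

lemma displacement_centre:
  assumes x: "x \<in> C"
  shows "(norm (T s (centre x) - centre x))\<^sup>2 \<le> (K\<^sup>2 - 1) * radius x"
proof -
  let ?p = "centre x"
  have p: "?p \<in> C"
    using x by (rule centre_in)
  have "radius x + (norm (T s ?p - ?p))\<^sup>2 \<le> \<Lambda> (\<lambda>t. (norm (T t x - T s ?p))\<^sup>2)"
    using radius_add_le[OF x T_in[OF p]] by (simp add: mean_square_dist_def)
  also have "\<dots> = \<Lambda> (\<lambda>t. (norm (T (s * t) x - T s ?p))\<^sup>2)"
    using mean_translate[OF dist_square_in[OF x]] by simp
  also have "\<dots> \<le> \<Lambda> (\<lambda>t. K\<^sup>2 * (norm (T t x - ?p))\<^sup>2)"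
  proof (rule mean_mono)
    show "(\<lambda>t. (norm (T (s * t) x - T s ?p))\<^sup>2) \<in> V"
      using translate_in[OF dist_square_in[OF x]] .
    show "(\<lambda>t. K\<^sup>2 * (norm (T t x - ?p))\<^sup>2) \<in> V"
      using scale_in[OF dist_square_in[OF x]] .
    fix t
    have "norm (T (s * t) x - T s ?p) \<le> K * norm (T t x - ?p)"
      using T_lipschitz[OF T_in[OF x] p] T_mult[OF x] by simp
    then show "(norm (T (s * t) x - T s ?p))\<^sup>2 \<le> K\<^sup>2 * (norm (T t x - ?p))\<^sup>2"
      by (metis norm_ge_zero power_mono power_mult_distrib)
  qed
  also have "\<dots> = K\<^sup>2 * radius x"
    using mean_scale[OF dist_square_in[OF x]] by (simp add: radius_def mean_square_dist_def)
  finally show ?thesis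
    by (simp add: algebra_simps)
qed

text \<open>
  Both terms on the left are controlled by the mean square distance of \<open>centre x\<close> from its own
  orbit, that is, by its displacements.
\<close>

lemma radius_centre_add_le:
  assumes x: "x \<in> C"
  shows "radius (centre x) + (norm (centre x - centre (centre x)))\<^sup>2 \<le> (K\<^sup>2 - 1) * radius x"
proof -
  have p: "centre x \<in> C"
    using x by (rule centre_in)
  have "radius (centre x) + (norm (centre x - centre (centre x)))\<^sup>2
      \<le> mean_square_dist (centre x) (centre x)"
    using p p by (rule radius_add_le)
  also have "\<dots> \<le> (K\<^sup>2 - 1) * radius x"
    using p displacement_centre[OF x] by (rule mean_square_dist_le)
  finally show ?thesis .
qed

lemma radius_centre: "x \<in> C \<Longrightarrow> radius (centre x) \<le> (K\<^sup>2 - 1) * radius x"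
  using radius_centre_add_le[of x] zero_le_power2[of "norm (centre x - centre (centre x))"]
  by linarith

text \<open>
  Adding the quadratic growth inequalities of the two orbits, each taken at the other centre,
  cancels all squares \<open>\<parallel>T\<^sub>t x\<parallel>\<^sup>2\<close> and leaves an inner product that is linear in \<open>T\<^sub>t x - T\<^sub>t y\<close>.
\<close>

lemma centre_lipschitz:
  assumes x: "x \<in> C" and y: "y \<in> C"
  shows "norm (centre x - centre y) \<le> K * norm (x - y)"
proof -
  let ?p = "centre x" and ?r = "centre y"
  let ?d = "norm (?p - ?r)"
  have "2 * ?d\<^sup>2 \<le> (mean_square_dist x ?r - mean_square_dist x ?p)
      - (mean_square_dist y ?r - mean_square_dist y ?p)"
    using radius_add_le[OF x centre_in[OF y]] radius_add_le[OF y centre_in[OF x]]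
    by (simp add: radius_def norm_minus_commute)
  also have "\<dots> = \<Lambda> (\<lambda>t. ((norm (T t x - ?r))\<^sup>2 - (norm (T t x - ?p))\<^sup>2)
      - ((norm (T t y - ?r))\<^sup>2 - (norm (T t y - ?p))\<^sup>2))"
    unfolding mean_square_dist_def
    by (simp add: mean_diff diff_in dist_square_in[OF x] dist_square_in[OF y])
  also have "\<dots> \<le> 2 * (K * norm (x - y) * ?d)"
  proof (rule mean_le)
    show "(\<lambda>t. ((norm (T t x - ?r))\<^sup>2 - (norm (T t x - ?p))\<^sup>2)
      - ((norm (T t y - ?r))\<^sup>2 - (norm (T t y - ?p))\<^sup>2)) \<in> V"
      by (simp add: diff_in dist_square_in[OF x] dist_square_in[OF y])
    fix t
    have "(T t x - T t y) \<bullet> (?p - ?r) \<le> norm (T t x - T t y) * ?d"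
      by (rule norm_cauchy_schwarz)
    also have "\<dots> \<le> K * norm (x - y) * ?d"
      by (intro mult_right_mono T_lipschitz x y) auto
    finally show "((norm (T t x - ?r))\<^sup>2 - (norm (T t x - ?p))\<^sup>2)
      - ((norm (T t y - ?r))\<^sup>2 - (norm (T t y - ?p))\<^sup>2) \<le> 2 * (K * norm (x - y) * ?d)"
      unfolding norm_square_mixed_difference by simp
  qed
  finally have "?d * ?d \<le> (K * norm (x - y)) * ?d"
    by (simp add: power2_eq_square)
  then show ?thesis
    using K_gt_1 by (cases "?d = 0") (auto simp: mult_le_cancel_right)
qed

lemma centre_fixed:
  assumes x: "x \<in> Fix C T"
  shows "centre x = x"
proof -
  have xC: "x \<in> C" and Tx: "\<And>t. T t x = x"
    using x by (auto simp: Fix_def)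
  have "radius x + (norm (x - centre x))\<^sup>2 \<le> 0"
    using radius_add_le[OF xC xC] by (simp add: mean_square_dist_def Tx mean_const)
  then have "(norm (x - centre x))\<^sup>2 \<le> 0"
    using radius_nonneg[OF xC] by linarith
  then show ?thesis by simp
qed

section \<open>Iterating the asymptotic centre\<close>

definition rate :: real
  where "rate = sqrt (K\<^sup>2 - 1)"

lemma rate_square: "rate\<^sup>2 = K\<^sup>2 - 1"
  and rate_pos: "0 < rate" and rate_less_1: "rate < 1"
proof -
  have "1 < K\<^sup>2"
    using K_gt_1 by simp
  then show "rate\<^sup>2 = K\<^sup>2 - 1" "0 < rate" "rate < 1"
    using K_square_less_2 by (auto simp: rate_def)
qed

lemma iterate_in: "x \<in> C \<Longrightarrow> (centre ^^ n) x \<in> C"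
  by (induction n) (simp_all add: centre_in)

lemma radius_iterate: "x \<in> C \<Longrightarrow> radius ((centre ^^ n) x) \<le> (diameter C * rate ^ n)\<^sup>2"
proof (induction n)
  case 0
  then show ?case by (simp add: radius_le_diameter_square)
next
  case (Suc n)
  have "radius ((centre ^^ Suc n) x) \<le> rate\<^sup>2 * radius ((centre ^^ n) x)"
    using radius_centre[OF iterate_in[OF Suc.prems]] by (simp add: rate_square)
  also have "\<dots> \<le> rate\<^sup>2 * (diameter C * rate ^ n)\<^sup>2"
    using Suc by (intro mult_left_mono) auto
  also have "\<dots> = (diameter C * rate ^ Suc n)\<^sup>2"
    by (simp add: power_mult_distrib mult_ac)
  finally show ?case .
qed

lemma rate_radius_iterate:
  assumes "x \<in> C" and "a\<^sup>2 \<le> (K\<^sup>2 - 1) * radius ((centre ^^ n) x)"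
  shows "a \<le> diameter C * rate ^ Suc n"
proof (rule power2_le_imp_le)
  have "a\<^sup>2 \<le> rate\<^sup>2 * radius ((centre ^^ n) x)"
    using assms(2) by (simp add: rate_square)
  also have "\<dots> \<le> rate\<^sup>2 * (diameter C * rate ^ n)\<^sup>2"
    using radius_iterate[OF assms(1)] by (intro mult_left_mono) auto
  also have "\<dots> = (diameter C * rate ^ Suc n)\<^sup>2"
    by (simp add: power_mult_distrib mult_ac)
  finally show "a\<^sup>2 \<le> (diameter C * rate ^ Suc n)\<^sup>2" .
qed (use diameter_C_nonneg rate_pos in simp)

lemma displacement_iterate:
  assumes x: "x \<in> C"
  shows "norm (T s ((centre ^^ n) x) - (centre ^^ n) x) \<le> diameter C * rate ^ n"
proof (cases n)
  case 0
  then show ?thesis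
    using norm_diff_le_diameter[OF T_in[OF x] x] by simp
next
  case (Suc m)
  then show ?thesis
    using rate_radius_iterate[OF x displacement_centre[OF iterate_in[OF x]]] by simp
qed

lemma step_iterate:
  assumes x: "x \<in> C"
  shows "norm ((centre ^^ Suc n) x - (centre ^^ n) x) \<le> diameter C * rate ^ n"
proof (cases n)
  case 0
  then show ?thesis
    using norm_diff_le_diameter[OF centre_in[OF x] x] by simp
next
  case (Suc m)
  let ?y = "(centre ^^ m) x"
  have y: "?y \<in> C"
    using x by (rule iterate_in)
  have "(norm (centre (centre ?y) - centre ?y))\<^sup>2 \<le> (K\<^sup>2 - 1) * radius ?y"
    using radius_centre_add_le[OF y] radius_nonneg[OF centre_in[OF y]]
    by (simp add: norm_minus_commute)
  then show ?thesis
    using rate_radius_iterate[OF x] Suc by simp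
qed

lemma iterate_lipschitz:
  "\<lbrakk>x \<in> C; y \<in> C\<rbrakk> \<Longrightarrow> norm ((centre ^^ n) x - (centre ^^ n) y) \<le> K ^ n * norm (x - y)"
proof (induction n)
  case 0
  then show ?case by simp
next
  case (Suc n)
  have "norm ((centre ^^ Suc n) x - (centre ^^ Suc n) y)
      \<le> K * norm ((centre ^^ n) x - (centre ^^ n) y)"
    using centre_lipschitz[OF iterate_in iterate_in] Suc.prems by simp
  also have "\<dots> \<le> K * (K ^ n * norm (x - y))"
    using Suc K_gt_1 by (intro mult_left_mono) auto
  finally show ?case
    by (simp add: mult.assoc)
qed

definition retraction :: "'h \<Rightarrow> 'h"
  where "retraction x = lim (\<lambda>n. (centre ^^ n) x)"

lemma
  assumes x: "x \<in> C"
  shows iterate_tendsto: "(\<lambda>n. (centre ^^ n) x) \<longlonglongrightarrow> retraction x"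
    and retraction_error:
      "norm (retraction x - (centre ^^ n) x) \<le> diameter C / (1 - rate) * rate ^ n"
proof -
  obtain L where L: "(\<lambda>n. (centre ^^ n) x) \<longlonglongrightarrow> L"
    "\<And>n. norm (L - (centre ^^ n) x) \<le> diameter C / (1 - rate) * rate ^ n"
    using geometric_steps_limit[OF less_imp_le[OF rate_pos] rate_less_1 step_iterate[OF x]] by blast
  then have "retraction x = L"
    unfolding retraction_def by (intro limI)
  with L show "(\<lambda>n. (centre ^^ n) x) \<longlonglongrightarrow> retraction x"
    and "norm (retraction x - (centre ^^ n) x) \<le> diameter C / (1 - rate) * rate ^ n"
    by auto
qed

lemma retraction_in_Fix:
  assumes x: "x \<in> C"
  shows "retraction x \<in> Fix C T"
proof -
  let ?u = "\<lambda>n. (centre ^^ n) x"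
  have RC: "retraction x \<in> C"
    using closed_sequentially[OF C_closed _ iterate_tendsto[OF x]] iterate_in[OF x] by blast
  have "T s (retraction x) = retraction x" for s
  proof -
    have "K-lipschitz_on C (T s)"
      using T_lipschitz K_gt_1 by (intro lipschitz_onI) (auto simp: dist_norm)
    then have "(\<lambda>n. T s (?u n)) \<longlonglongrightarrow> T s (retraction x)"
      using continuous_on_tendsto_compose[OF lipschitz_on_continuous_on iterate_tendsto[OF x] RC]
        iterate_in[OF x] by simp
    then have "(\<lambda>n. T s (?u n) - ?u n) \<longlonglongrightarrow> T s (retraction x) - retraction x"
      using iterate_tendsto[OF x] by (rule tendsto_diff)
    moreover have "(\<lambda>n. T s (?u n) - ?u n) \<longlonglongrightarrow> 0"
    proof (rule Lim_null_comparison)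
      show "\<forall>\<^sub>F n in sequentially. norm (T s (?u n) - ?u n) \<le> diameter C * rate ^ n"
        using displacement_iterate[OF x] by simp
      show "(\<lambda>n. diameter C * rate ^ n) \<longlonglongrightarrow> 0"
        using tendsto_mult_right_zero[OF LIMSEQ_power_zero[of rate]] rate_pos rate_less_1 by simp
    qed
    ultimately show ?thesis
      using LIMSEQ_unique by fastforce
  qed
  then show ?thesis
    using RC by (auto simp: Fix_def)
qed

lemma retraction_fixed:
  assumes x: "x \<in> Fix C T"
  shows "retraction x = x"
proof -
  have "(centre ^^ n) x = x" for n
    by (induction n) (simp_all add: centre_fixed[OF x])
  then show ?thesis
    by (simp add: retraction_def)
qed

text \<open>
  Approximating both values of the retraction by \<open>n\<close>-th iterates costs a multiple of \<open>rate ^ n\<close>,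
  and the iterates themselves are \<open>K ^ n\<close>-Lipschitzian; the choice of \<open>n\<close> is free.
\<close>

lemma hoelder_continuous_on_retraction: "hoelder_continuous_on C retraction"
proof -
  define A where "A = 2 * (diameter C / (1 - rate))"
  have A: "0 \<le> A"
    using diameter_C_nonneg rate_less_1 by (simp add: A_def)
  have split: "norm (retraction x - retraction y) \<le> A * rate ^ n + K ^ n * norm (x - y)"
    if x: "x \<in> C" and y: "y \<in> C" for x y n
  proof -
    let ?e = "diameter C / (1 - rate) * rate ^ n"
    have "retraction x - retraction y = (retraction x - (centre ^^ n) x)
        - (retraction y - (centre ^^ n) y) + ((centre ^^ n) x - (centre ^^ n) y)"
      by simp
    also have "norm \<dots> \<le> ?e + ?e + K ^ n * norm (x - y)"
      by (intro order_trans[OF norm_triangle_ineq] add_mono order_trans[OF norm_triangle_ineq4]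
          retraction_error iterate_lipschitz x y)
    also have "\<dots> = A * rate ^ n + K ^ n * norm (x - y)"
      by (simp add: A_def)
    finally show ?thesis .
  qed
  obtain M \<alpha> where M: "0 \<le> M" "0 < \<alpha>" "\<alpha> \<le> 1"
    and bound: "\<And>a d. \<lbrakk>0 \<le> d; d \<le> diameter C; \<And>n. a \<le> A * rate ^ n + K ^ n * d\<rbrakk>
      \<Longrightarrow> a \<le> M * d powr \<alpha>"
    using geometric_tradeoff_powr_bound[OF rate_pos rate_less_1 K_gt_1 A diameter_C_nonneg] by blast
  have "\<forall>x\<in>C. \<forall>y\<in>C. norm (retraction x - retraction y) \<le> M * norm (x - y) powr \<alpha>"
    by (intro ballI bound norm_diff_le_diameter split norm_ge_zero)
  with M show ?thesis
    unfolding hoelder_continuous_on_def by blast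
qed

theorem Fix_hoelder_retract: "hoelder_retract_of (Fix C T) C"
  unfolding hoelder_retract_of_def
proof (intro conjI exI)
  show "Fix C T \<subseteq> C"
    by (auto simp: Fix_def)
  show "retraction \<in> C \<rightarrow> Fix C T"
    using retraction_in_Fix by blast
  show "\<forall>x\<in>Fix C T. retraction x = x"
    using retraction_fixed by blast
  show "hoelder_continuous_on C retraction"
    by (rule hoelder_continuous_on_retraction)
qed

end

section \<open>Fixed points of uniformly Lipschitzian semigroups\<close>

lemma uniformly_lipschitzian_semigroup_mono:
  assumes "uniformly_lipschitzian_semigroup k C T" and "k \<le> K"
  shows "uniformly_lipschitzian_semigroup K C T"
  using assms order_trans[OF _ mult_right_mono[OF \<open>k \<le> K\<close> norm_ge_zero]]
  unfolding uniformly_lipschitzian_semigroup_def by blast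

theorem theorem2:
  fixes C :: "'h::{real_inner, complete_space} set"
    and T :: "'s::semitopological_semigroup \<Rightarrow> 'h \<Rightarrow> 'h"
    and X :: "'s linf set"
    and k :: real
  assumes "C \<noteq> {}" and "bounded C" and "closed C" and "convex C"
    and "uniformly_lipschitzian_semigroup k C T"
    and "subspace X" and "closed X"
    and "const_bcontfun 1 \<in> X"
    and "\<And>s. left_translate s ` X \<subseteq> X"
    and "\<And>s. right_translate s ` X \<subseteq> X"
    and "left_amenable X"
    and "\<And>x y. x \<in> C \<Longrightarrow> (\<lambda>t. T t x \<bullet> y) \<in> linf_apply ` X"
    and "\<And>x y. x \<in> C \<Longrightarrow> (\<lambda>t. (norm (T t x - y))\<^sup>2) \<in> linf_apply ` X"
    and "k < sqrt 2"
  shows "(\<exists>x\<in>C. \<forall>t. T t x = x) \<and> hoelder_retract_of (Fix C T) C"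
proof -
  \<comment> \<open>Any \<open>K\<close> in \<open>[k, \<surd>2)\<close> above \<open>1\<close> would do; \<open>6/5\<close> has square \<open>36/25 < 2\<close>.\<close>
  define K where "K = max k (6/5)"
  have K: "k \<le> K" "1 < K"
    by (auto simp: K_def)
  have "6/5 < sqrt 2"
    by (rule real_less_rsqrt) (simp add: power2_eq_square)
  then have "K < sqrt 2"
    using \<open>k < sqrt 2\<close> by (simp add: K_def)
  then have "K\<^sup>2 < (sqrt 2)\<^sup>2"
    using K(2) by (intro power_strict_mono) auto
  then have K2: "K\<^sup>2 < 2"
    by simp
  obtain \<Lambda> where \<Lambda>: "left_invariant_mean (linf_apply ` X) \<Lambda>"
    using left_invariant_mean_of_left_amenable assms(6,8,9,11) by blast
  interpret left_invariant_mean "linf_apply ` X" \<Lambda>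
    by (rule \<Lambda>)
  interpret lipschitzian_semigroup_with_mean "linf_apply ` X" \<Lambda> C T K
    using assms(1-4,13) K K2 uniformly_lipschitzian_semigroup_mono[OF assms(5) K(1)]
    by unfold_locales auto
  obtain x where "x \<in> C"
    using \<open>C \<noteq> {}\<close> by blast
  then have "\<exists>x\<in>C. \<forall>t. T t x = x"
    using retraction_in_Fix[of x] by (auto simp: Fix_def)
  then show ?thesis
    using Fix_hoelder_retract by blast
qed

end
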